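(* Let $R=V_r$ be an admissible causal inverse on $X=C[0,T]$ and $A=R^{-1}$ with domain $\mathcal D(A)=R(X)$. Let $B_1,\dots,B_N$ be linear operators on $\mathcal D(A)$ with $B_jR=V_{q_j}$, where $q_j\in L^1(0,T)$ and $|q_j(t)|\le C_jt^{\eta_j-1}$ a.e. on $(0,T)$ for some $C_j>0$, $\eta_j>0$. Let $p_1,\dots,p_N\in C[0,T]$, $K\in C(\Delta_T)$, and $$Lu=Au+\sum_{j=1}^{N}p_j(t)B_ju(t)+\int_0^tK(t,s)u(s)\,ds .$$ Let $W_L=V_{G_L}$ with $$G_L(t,s)=\sum_{j=1}^{N}p_j(t)q_j(t-s)+\int_s^tK(t,\xi)r(\xi-s)\,d\xi .$$ Then, on $\mathcal D(A)$, $L=(I+W_L)A$.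
   Context: Fix $T>0$; functions are complex-valued; $\Delta_T=\{(t,s):0\le s\le t\le T\}$. For a univariate kernel $r\in L^1(0,T)$, $(V_rf)(t)=\int_0^tr(t-s)f(s)\,ds$; for a bivariate kernel $G$, $(V_Gf)(t)=\int_0^tG(t,s)f(s)\,ds$. An admissible causal inverse is an injective convolution operator $R=V_r:C[0,T]\to C[0,T]$, $r\in L^1(0,T)$, such that $|r(t)|\le C_0t^{\eta_0-1}$ for a.e. $0<t\le T$, for some $C_0>0$, $\eta_0>0$. *)

theory Defs
  imports "HOL-Analysis.Analysis"
begin

text \<open>
  A function on \<open>[0,T]\<close> is represented by its extension by \<open>0\<close> to the whole real line. Functions on
  \<open>[0,T]\<close> are then equal exactly when their representatives are, and pointwise sums and
  scalar multiples of representatives are again representatives. So injectivity and inverses of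
  operators on \<open>C[0,T]\<close> have their literal meaning.
\<close>

definition C_interval :: "real \<Rightarrow> (real \<Rightarrow> complex) set" where
  "C_interval T = {f. continuous_on {0..T} f \<and> (\<forall>t. t \<notin> {0..T} \<longrightarrow> f t = 0)}"

definition causal_triangle :: "real \<Rightarrow> (real \<times> real) set" where
  "causal_triangle T = {(t, s). 0 \<le> s \<and> s \<le> t \<and> t \<le> T}"

definition volterra ::
  "real \<Rightarrow> (real \<Rightarrow> real \<Rightarrow> complex) \<Rightarrow> (real \<Rightarrow> complex) \<Rightarrow> (real \<Rightarrow> complex)" where
  "volterra T G f =
    (\<lambda>t. if t \<in> {0..T} then (LINT s:{0..t}|lebesgue. G t s * f s) else 0)"

definition convolution ::
  "real \<Rightarrow> (real \<Rightarrow> complex) \<Rightarrow> (real \<Rightarrow> complex) \<Rightarrow> (real \<Rightarrow> complex)" where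
  "convolution T r = volterra T (\<lambda>t s. r (t - s))"

text \<open>
  Elements of \<open>L\<^sup>1(0,T)\<close> are given by arbitrary Lebesgue integrable representatives; their values
  outside \<open>(0,T)\<close> are never constrained and do not affect \<^const>\<open>convolution\<close>.
\<close>

definition power_bounded_kernel :: "real \<Rightarrow> (real \<Rightarrow> complex) \<Rightarrow> bool" where
  "power_bounded_kernel T q \<longleftrightarrow>
     q absolutely_integrable_on {0<..<T} \<and>
     (\<exists>C>0. \<exists>\<eta>>0. AE t in lebesgue. t \<in> {0<..<T} \<longrightarrow> norm (q t) \<le> C * t powr (\<eta> - 1))"

definition admissible_causal_inverse :: "real \<Rightarrow> (real \<Rightarrow> complex) \<Rightarrow> bool" where
  "admissible_causal_inverse T r \<longleftrightarrow>
     power_bounded_kernel T r \<and>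
     convolution T r \<in> C_interval T \<rightarrow> C_interval T \<and>
     inj_on (convolution T r) (C_interval T)"

definition generator_domain :: "real \<Rightarrow> (real \<Rightarrow> complex) \<Rightarrow> (real \<Rightarrow> complex) set" where
  "generator_domain T r = convolution T r ` C_interval T"

definition generator ::
  "real \<Rightarrow> (real \<Rightarrow> complex) \<Rightarrow> (real \<Rightarrow> complex) \<Rightarrow> (real \<Rightarrow> complex)" where
  "generator T r = inv_into (C_interval T) (convolution T r)"

definition linear_operator_on ::
  "(real \<Rightarrow> complex) set \<Rightarrow> ((real \<Rightarrow> complex) \<Rightarrow> (real \<Rightarrow> complex)) \<Rightarrow> bool" where
  "linear_operator_on D B \<longleftrightarrow>
     (\<forall>u\<in>D. \<forall>v\<in>D. B (\<lambda>t. u t + v t) = (\<lambda>t. B u t + B v t)) \<and>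
     (\<forall>c. \<forall>u\<in>D. B (\<lambda>t. c * u t) = (\<lambda>t. c * B u t))"

definition perturbed_operator ::
  "real \<Rightarrow> (real \<Rightarrow> complex) \<Rightarrow> nat \<Rightarrow> (nat \<Rightarrow> real \<Rightarrow> complex) \<Rightarrow>
   (nat \<Rightarrow> (real \<Rightarrow> complex) \<Rightarrow> (real \<Rightarrow> complex)) \<Rightarrow> (real \<Rightarrow> real \<Rightarrow> complex) \<Rightarrow>
   (real \<Rightarrow> complex) \<Rightarrow> (real \<Rightarrow> complex)" where
  "perturbed_operator T r N p B K u =
    (\<lambda>t. generator T r u t + (\<Sum>j=1..N. p j t * B j u t) + volterra T K u t)"

definition perturbation_kernel ::
  "(real \<Rightarrow> complex) \<Rightarrow> nat \<Rightarrow> (nat \<Rightarrow> real \<Rightarrow> complex) \<Rightarrow> (nat \<Rightarrow> real \<Rightarrow> complex) \<Rightarrow>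
   (real \<Rightarrow> real \<Rightarrow> complex) \<Rightarrow> real \<Rightarrow> real \<Rightarrow> complex" where
  "perturbation_kernel r N p q K t s =
    (\<Sum>j=1..N. p j t * q j (t - s)) + (LINT \<xi>:{s..t}|lebesgue. K t \<xi> * r (\<xi> - s))"

end

theory Submission
  imports Defs
begin

text \<open>
  Write \<open>u = R f\<close> with \<open>f\<close> in \<open>C[0,T]\<close>, so that \<open>A u = f\<close> and \<open>B\<^sub>j u = V\<^bsub>q\<^sub>j\<^esub> f\<close>. The terms with
  \<open>p\<^sub>j\<close> on both sides then agree by linearity of the integral, and what is left is to compute \<open>V\<^sub>K R f\<close>
  as a single Volterra operator applied to \<open>f\<close>: at time \<open>t\<close>, exchange the order of integration
  in the integral of \<open>K(t,\<xi>) r(\<xi>-s) f(s)\<close> over \<open>0 \<le> s \<le> \<xi> \<le> t\<close>. The exchange is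
  legitimate because \<open>K(t,\<sqdot>)\<close> is bounded and \<open>r\<close> and \<open>f\<close> are integrable
  (\<open>integrable_convolution_integrand\<close>).

  The one technical obstacle is measurability. The kernel \<open>r\<close> is only Lebesgue measurable, so
  \<open>(\<xi>,s) \<mapsto> r(\<xi>-s)\<close> need not be measurable for the product of two Lebesgue measures.
  Hence each kernel is replaced by a Borel function that agrees with it almost everywhere on \<open>(0,T)\<close>
  and vanishes elsewhere (\<open>borel_representative_exists\<close>). In addition to making Tonelli and Fubini
  available on \<^term>\<open>lborel\<close>, the extension by zero absorbs all the constraints \<open>s \<le> \<xi>\<close>,
  so that every integral can be taken over the whole line.
\<close>

section \<open>Borel representatives of Lebesgue integrable kernels\<close>

text \<open>
  Lebesgue measure is complete, so a function that is almost everywhere equal to a Borel function is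
  automatically measurable. This is what brings an integral computed on \<^term>\<open>lborel\<close> back to
  the original kernels.
\<close>

lemma has_bochner_integral_lebesgue_of_lborel:
  fixes f g :: "real \<Rightarrow> complex"
  assumes g: "has_bochner_integral lborel g x" and ae: "AE t in lborel. f t = g t"
  shows "has_bochner_integral lebesgue f x"
proof -
  have gm: "g \<in> borel_measurable lborel"
    using g by (rule borel_measurable_has_bochner_integral)
  have ae': "AE t in lebesgue. g t = f t"
    using AE_completion[OF ae] by (simp add: eq_commute)
  have glm: "g \<in> borel_measurable lebesgue"
    using gm by (rule measurable_completion)
  have "has_bochner_integral lebesgue g x"
    using g gm by (simp add: has_bochner_integral_iff integrable_completion integral_completion)
  moreover have "f \<in> borel_measurable lebesgue"
  proof (rule measurableI)
    fix A :: "complex set" assume A: "A \<in> sets borel"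
    have eq: "AE t in lebesgue. t \<in> g -` A \<longleftrightarrow> t \<in> f -` A"
      using ae' by eventually_elim simp
    have "g -` A \<in> sets lebesgue"
      using measurable_sets[OF glm A] by simp
    then show "f -` A \<inter> space lebesgue \<in> sets lebesgue"
      using completion.in_sets_AE[OF eq] by simp
  qed simp
  ultimately show ?thesis
    using ae' by (rule has_bochner_integralI_AE)
qed

definition borel_representative :: "real \<Rightarrow> (real \<Rightarrow> complex) \<Rightarrow> (real \<Rightarrow> complex) \<Rightarrow> bool" where
  "borel_representative T q \<rho> \<longleftrightarrow>
     integrable lborel \<rho> \<and> (\<forall>x. x \<notin> {0<..<T} \<longrightarrow> \<rho> x = 0) \<and>
     (AE x in lborel. x \<in> {0<..<T} \<longrightarrow> q x = \<rho> x)"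

lemma borel_representative_exists:
  assumes "q absolutely_integrable_on {0<..<T}"
  shows "\<exists>\<rho>. borel_representative T q \<rho>"
proof -
  let ?g = "\<lambda>x. indicator {0<..<T} x *\<^sub>R q x"
  have g: "integrable lebesgue ?g"
    using assms by (simp add: set_integrable_def)
  have gm: "?g \<in> borel_measurable lebesgue"
    using g by (rule borel_measurable_integrable)
  have re: "(\<lambda>x. Re (?g x)) \<in> borel_measurable lebesgue"
    and im: "(\<lambda>x. Im (?g x)) \<in> borel_measurable lebesgue"
    using gm by measurable
  obtain a b :: "real \<Rightarrow> real" where [measurable]: "a \<in> borel_measurable lborel" "b \<in> borel_measurable lborel"
    and a: "AE x in lborel. Re (?g x) = a x" and b: "AE x in lborel. Im (?g x) = b x"
    using completion_ex_borel_measurable_real[OF re] completion_ex_borel_measurable_real[OF im] by blast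
  define \<rho> where "\<rho> = (\<lambda>x. indicator {0<..<T} x *\<^sub>R (of_real (a x) + \<i> * of_real (b x)))"
  have [measurable]: "\<rho> \<in> borel_measurable lborel"
    unfolding \<rho>_def by measurable
  have eq: "AE x in lborel. ?g x = \<rho> x"
    using a b
  proof eventually_elim
    case (elim x)
    have "?g x = of_real (a x) + \<i> * of_real (b x)"
      using elim by (simp add: complex_eq_iff)
    then show ?case
      by (auto simp: \<rho>_def indicator_def)
  qed
  have "integrable lebesgue \<rho>"
    using g measurable_completion[OF \<open>\<rho> \<in> borel_measurable lborel\<close>] AE_completion[OF eq]
    by (rule integrable_cong_AE_imp)
  then have "integrable lborel \<rho>"
    by (simp add: integrable_completion)
  moreover have "AE x in lborel. x \<in> {0<..<T} \<longrightarrow> q x = \<rho> x"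
    using eq by eventually_elim auto
  ultimately show ?thesis
    unfolding borel_representative_def by (auto simp: \<rho>_def)
qed

text \<open>
  The predicate to be translated will say that a kernel agrees with its Borel representative, so it
  is not Borel in general; a Borel null set that contains the exceptional points is translated
  instead.
\<close>

lemma AE_lborel_affine:
  fixes c t :: real
  assumes "c \<noteq> 0" "AE x in lborel. P x"
  shows "AE x in lborel. P (t + c * x)"
proof -
  obtain N where N: "{x \<in> space lborel. \<not> P x} \<subseteq> N" "N \<in> null_sets lborel"
    using assms(2) by (auto simp: eventually_ae_filter)
  have [measurable]: "N \<in> sets borel"
    using N(2) by auto
  have "AE x in lborel. t + c * x \<notin> N"
    using assms(1) AE_not_in[OF N(2)]
    by (intro AE_borel_affine[where P = "\<lambda>x. x \<notin> N"]) measurable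
  then show ?thesis
    using N(1) by (auto elim: eventually_mono)
qed

section \<open>Integrability of the convolution integrands\<close>

lemma continuous_on_Icc_zero_extension:
  fixes g :: "real \<Rightarrow> complex"
  assumes g: "continuous_on {a..b} g" and 0: "\<And>x. x \<notin> {a..b} \<Longrightarrow> g x = 0"
  shows "g \<in> borel_measurable borel" and "\<exists>M. \<forall>x. norm (g x) \<le> M" and "integrable lborel g"
proof -
  have eq: "(\<lambda>x. indicator {a..b} x *\<^sub>R g x) = g"
    using 0 by (auto simp: fun_eq_iff indicator_def)
  show "g \<in> borel_measurable borel"
    using borel_measurable_continuous_on_indicator[OF _ g] by (simp add: eq)
  show "integrable lborel g"
    using borel_integrable_atLeastAtMost'[OF g] by (simp add: set_integrable_def eq)
  have "bounded (g ` {a..b})"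
    using g by (intro compact_imp_bounded compact_continuous_image) auto
  then obtain M where M: "\<And>x. x \<in> {a..b} \<Longrightarrow> norm (g x) \<le> M"
    by (force simp: bounded_iff)
  have "norm (g x) \<le> max M 0" for x
    using M[of x] 0[of x] by (cases "x \<in> {a..b}") auto
  then show "\<exists>M. \<forall>x. norm (g x) \<le> M"
    by blast
qed

lemma integrable_mult_bounded:
  fixes \<rho> g :: "real \<Rightarrow> complex"
  assumes \<rho>: "integrable lborel \<rho>" and [measurable]: "g \<in> borel_measurable borel"
    and M: "\<And>x. norm (g x) \<le> M"
  shows "integrable lborel (\<lambda>x. \<rho> x * g x)"
proof (rule Bochner_Integration.integrable_bound)
  show "integrable lborel (\<lambda>x. M *\<^sub>R \<rho> x)"
    using \<rho> by simp
  have [measurable]: "\<rho> \<in> borel_measurable borel"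
    using \<rho> by (auto dest: borel_measurable_integrable)
  show "(\<lambda>x. \<rho> x * g x) \<in> borel_measurable lborel"
    by measurable
  have "norm (\<rho> x * g x) \<le> norm (M *\<^sub>R \<rho> x)" for x
    using mult_right_mono[OF order_trans[OF M[of x] abs_ge_self] norm_ge_zero[of "\<rho> x"]]
    by (simp add: norm_mult mult.commute)
  then show "AE x in lborel. norm (\<rho> x * g x) \<le> norm (M *\<^sub>R \<rho> x)"
    by simp
qed

text \<open>
  Fixing \<open>s\<close> and integrating over \<open>\<xi>\<close> first bounds the integrand by
  \<open>sup \<bar>k\<bar> \<cdot> \<parallel>\<rho>\<parallel>\<^sub>1 \<cdot> \<bar>f s\<bar>\<close>, since the \<open>L\<^sup>1\<close> norm is translation invariant.
\<close>

lemma integrable_convolution_integrand: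
  fixes \<rho> k f :: "real \<Rightarrow> complex"
  assumes \<rho>: "integrable lborel \<rho>" and f: "integrable lborel f"
    and [measurable]: "k \<in> borel_measurable borel" and M: "\<And>x. norm (k x) \<le> M"
  shows "integrable (lborel \<Otimes>\<^sub>M lborel) (\<lambda>(s, \<xi>). k \<xi> * \<rho> (\<xi> - s) * f s)"
proof (rule lborel_pair.Fubini_integrable)
  have [measurable]: "\<rho> \<in> borel_measurable borel" "f \<in> borel_measurable borel"
    using \<rho> f by (auto dest: borel_measurable_integrable)
  show "(\<lambda>(s, \<xi>). k \<xi> * \<rho> (\<xi> - s) * f s) \<in> borel_measurable (lborel \<Otimes>\<^sub>M lborel)"
    by measurable
  have shift: "integrable lborel (\<lambda>\<xi>. \<rho> (\<xi> - s))" for s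
    using lborel_integrable_real_affine[OF \<rho>, of 1 "- s"] by (simp add: algebra_simps)
  have int: "integrable lborel (\<lambda>\<xi>. k \<xi> * \<rho> (\<xi> - s) * f s)" for s
    using integrable_mult_bounded[OF shift[of s] _ M] by (simp add: mult.commute)
  then show "AE s in lborel. integrable lborel (\<lambda>\<xi>. case (s, \<xi>) of (s, \<xi>) \<Rightarrow> k \<xi> * \<rho> (\<xi> - s) * f s)"
    by simp
  define C where "C = M * (\<integral>x. norm (\<rho> x) \<partial>lborel)"
  have bound: "(\<integral>\<xi>. norm (k \<xi> * \<rho> (\<xi> - s) * f s) \<partial>lborel) \<le> C * norm (f s)" for s
  proof -
    have "(\<integral>\<xi>. norm (k \<xi> * \<rho> (\<xi> - s) * f s) \<partial>lborel) \<le> (\<integral>\<xi>. M * norm (\<rho> (\<xi> - s)) * norm (f s) \<partial>lborel)"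
    proof (rule integral_mono)
      show "integrable lborel (\<lambda>\<xi>. norm (k \<xi> * \<rho> (\<xi> - s) * f s))"
        using int by (rule integrable_norm)
      show "integrable lborel (\<lambda>\<xi>. M * norm (\<rho> (\<xi> - s)) * norm (f s))"
        using integrable_norm[OF shift[of s]] by (intro integrable_mult_left integrable_mult_right)
      show "norm (k \<xi> * \<rho> (\<xi> - s) * f s) \<le> M * norm (\<rho> (\<xi> - s)) * norm (f s)" for \<xi>
        using M by (auto simp: norm_mult intro!: mult_right_mono)
    qed
    also have "\<dots> = M * (\<integral>\<xi>. norm (\<rho> (\<xi> - s)) \<partial>lborel) * norm (f s)"
      by simp
    also have "(\<integral>\<xi>. norm (\<rho> (\<xi> - s)) \<partial>lborel) = (\<integral>x. norm (\<rho> x) \<partial>lborel)"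
      using lborel_integral_real_affine[of 1 "\<lambda>x. norm (\<rho> x)" "- s"] by (simp add: algebra_simps)
    finally show ?thesis
      by (simp add: C_def)
  qed
  have "integrable lborel (\<lambda>s. \<integral>\<xi>. norm (k \<xi> * \<rho> (\<xi> - s) * f s) \<partial>lborel)"
  proof (rule Bochner_Integration.integrable_bound)
    show "integrable lborel (\<lambda>s. C * norm (f s))"
      using f by simp
    show "(\<lambda>s. \<integral>\<xi>. norm (k \<xi> * \<rho> (\<xi> - s) * f s) \<partial>lborel) \<in> borel_measurable lborel"
      by measurable
    have "norm (\<integral>\<xi>. norm (k \<xi> * \<rho> (\<xi> - s) * f s) \<partial>lborel) \<le> norm (C * norm (f s))" for s
      using order_trans[OF bound[of s] abs_ge_self] by simp
    then show "AE s in lborel. norm (\<integral>\<xi>. norm (k \<xi> * \<rho> (\<xi> - s) * f s) \<partial>lborel) \<le> norm (C * norm (f s))"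
      by simp
  qed
  then show "integrable lborel (\<lambda>s. \<integral>\<xi>. norm (case (s, \<xi>) of (s, \<xi>) \<Rightarrow> k \<xi> * \<rho> (\<xi> - s) * f s) \<partial>lborel)"
    by simp
qed

section \<open>From integrals over intervals to integrals over the line\<close>

text \<open>
  The factor \<open>\<rho> (t - s)\<close> vanishes for \<open>s \<ge> t\<close> and \<open>f s\<close> vanishes for \<open>s < 0\<close>, so the integral
  that defines \<open>V\<^sub>q f\<close> at \<open>t\<close> does not change when it is extended to the whole line.
\<close>

lemma has_bochner_integral_convolution_integrand:
  assumes \<rho>: "borel_representative T q \<rho>" and f: "f \<in> C_interval T" and t: "t \<in> {0..T}"
  shows "has_bochner_integral lebesgue (\<lambda>s. indicator {0..t} s *\<^sub>R (q (t - s) * f s))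
           (\<integral>s. \<rho> (t - s) * f s \<partial>lborel)"
proof (rule has_bochner_integral_lebesgue_of_lborel)
  have f': "continuous_on {0..T} f" "\<And>x. x \<notin> {0..T} \<Longrightarrow> f x = 0"
    using f by (auto simp: C_interval_def)
  obtain M where M: "\<And>x. norm (f x) \<le> M"
    using continuous_on_Icc_zero_extension(2)[OF f'] by blast
  have "integrable lborel (\<lambda>s. \<rho> (t - s))"
    using lborel_integrable_real_affine[of \<rho> "- 1" t] \<rho> by (simp add: borel_representative_def)
  from integrable_mult_bounded[OF this continuous_on_Icc_zero_extension(1)[OF f'] M]
  show "has_bochner_integral lborel (\<lambda>s. \<rho> (t - s) * f s) (\<integral>s. \<rho> (t - s) * f s \<partial>lborel)"
    by (simp add: has_bochner_integral_iff)
  have "AE s in lborel. t + (- 1) * s \<in> {0<..<T} \<longrightarrow> q (t + (- 1) * s) = \<rho> (t + (- 1) * s)"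
    using \<rho> by (intro AE_lborel_affine) (auto simp: borel_representative_def)
  \<comment> \<open>\<open>q\<close> is arbitrary at \<open>0\<close> and at \<open>T\<close>; for \<open>s\<close> in \<open>[0,t]\<close>
    its argument takes these values at most for \<open>s = t\<close> and \<open>s = 0\<close>.\<close>
  then show "AE s in lborel. indicator {0..t} s *\<^sub>R (q (t - s) * f s) = \<rho> (t - s) * f s"
    using AE_lborel_singleton[of 0] AE_lborel_singleton[of t]
  proof eventually_elim
    case (elim s)
    consider "s < 0" | "t < s" | "0 < s" "s < t"
      using elim by linarith
    then show ?case
    proof cases
      case 1 then show ?thesis using f'(2)[of s] by simp
    next
      case 2 then show ?thesis using \<rho> by (simp add: borel_representative_def)
    next
      case 3 then show ?thesis using elim t by simp
    qed
  qed
qed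

lemma set_integral_shifted_kernel:
  assumes \<rho>: "borel_representative T r \<rho>" and s: "0 \<le> s" "s \<le> t" "t \<le> T"
    and k: "continuous_on {0..t} k"
  shows "(LINT \<xi>:{s..t}|lebesgue. k \<xi> * r (\<xi> - s)) =
    (\<integral>\<xi>. (indicator {0..t} \<xi> *\<^sub>R k \<xi>) * \<rho> (\<xi> - s) \<partial>lborel)"
proof -
  let ?k = "\<lambda>\<xi>. indicator {0..t} \<xi> *\<^sub>R k \<xi>"
  have k': "continuous_on {0..t} ?k" "\<And>x. x \<notin> {0..t} \<Longrightarrow> ?k x = 0"
    using k by (auto intro: continuous_on_cong[THEN iffD1, OF refl _ k])
  obtain M where M: "\<And>x. norm (?k x) \<le> M"
    using continuous_on_Icc_zero_extension(2)[OF k'] by blast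
  have "integrable lborel (\<lambda>\<xi>. \<rho> (\<xi> - s))"
    using lborel_integrable_real_affine[of \<rho> 1 "- s"] \<rho> by (simp add: borel_representative_def)
  from integrable_mult_bounded[OF this continuous_on_Icc_zero_extension(1)[OF k'] M]
  have "has_bochner_integral lborel (\<lambda>\<xi>. ?k \<xi> * \<rho> (\<xi> - s)) (\<integral>\<xi>. ?k \<xi> * \<rho> (\<xi> - s) \<partial>lborel)"
    by (simp add: has_bochner_integral_iff mult.commute)
  moreover have "AE \<xi> in lborel. - s + 1 * \<xi> \<in> {0<..<T} \<longrightarrow> r (- s + 1 * \<xi>) = \<rho> (- s + 1 * \<xi>)"
    using \<rho> by (intro AE_lborel_affine) (auto simp: borel_representative_def)
  then have "AE \<xi> in lborel. indicator {s..t} \<xi> *\<^sub>R (k \<xi> * r (\<xi> - s)) = ?k \<xi> * \<rho> (\<xi> - s)"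
    using AE_lborel_singleton[of s] AE_lborel_singleton[of t]
  proof eventually_elim
    case (elim \<xi>)
    consider "\<xi> < s" | "t < \<xi>" | "s < \<xi>" "\<xi> < t"
      using elim by linarith
    then show ?case
    proof cases
      case 1 then show ?thesis using \<rho> by (simp add: borel_representative_def)
    next
      case 2 then show ?thesis by simp
    next
      case 3 then show ?thesis using elim s by simp
    qed
  qed
  ultimately show ?thesis
    unfolding set_lebesgue_integral_def
    by (intro has_bochner_integral_integral_eq has_bochner_integral_lebesgue_of_lborel)
qed

section \<open>Composition with a convolution\<close>

text \<open>
  The Fubini step \<open>V\<^sub>K R = V\<^sub>H\<close> with \<open>H(t,s) = \<integral>\<^sub>s\<^sup>t K(t,\<xi>) r(\<xi>-s) d\<xi>\<close>, at a fixed time \<open>t\<close> and with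
  \<open>k = K(t,\<sqdot>)\<close>. It asserts convergence of the integral as well as its value, because it is
  going to be added to the integrals that come from the \<open>q\<^sub>j\<close>.
\<close>

lemma has_bochner_integral_volterra_convolution:
  assumes \<rho>: "borel_representative T r \<rho>" and f: "f \<in> C_interval T" and t: "t \<in> {0..T}"
    and k: "continuous_on {0..t} k"
  shows "has_bochner_integral lebesgue
           (\<lambda>s. indicator {0..t} s *\<^sub>R ((LINT \<xi>:{s..t}|lebesgue. k \<xi> * r (\<xi> - s)) * f s))
           (LINT \<xi>:{0..t}|lebesgue. k \<xi> * convolution T r f \<xi>)"
proof -
  let ?k = "\<lambda>\<xi>. indicator {0..t} \<xi> *\<^sub>R k \<xi>"
  let ?h = "\<lambda>s \<xi>. ?k \<xi> * \<rho> (\<xi> - s) * f s"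
  have k': "continuous_on {0..t} ?k" "\<And>x. x \<notin> {0..t} \<Longrightarrow> ?k x = 0"
    using k by (auto intro: continuous_on_cong[THEN iffD1, OF refl _ k])
  obtain M where M: "\<And>x. norm (?k x) \<le> M"
    using continuous_on_Icc_zero_extension(2)[OF k'] by blast
  have f': "continuous_on {0..T} f" "\<And>x. x \<notin> {0..T} \<Longrightarrow> f x = 0"
    using f by (auto simp: C_interval_def)
  have h: "integrable (lborel \<Otimes>\<^sub>M lborel) (case_prod ?h)"
    using \<rho>[unfolded borel_representative_def, THEN conjunct1]
      continuous_on_Icc_zero_extension(3)[OF f'] continuous_on_Icc_zero_extension(1)[OF k'] M
    by (rule integrable_convolution_integrand)
  have conv: "convolution T r f \<xi> = (\<integral>s. \<rho> (\<xi> - s) * f s \<partial>lborel)" if "\<xi> \<in> {0..T}" for \<xi>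
    using that has_bochner_integral_integral_eq[OF has_bochner_integral_convolution_integrand[OF \<rho> f that]]
    by (simp add: convolution_def volterra_def set_lebesgue_integral_def)
  have "has_bochner_integral lborel (\<lambda>s. \<integral>\<xi>. ?h s \<xi> \<partial>lborel) (\<integral>\<xi>. (\<integral>s. ?h s \<xi> \<partial>lborel) \<partial>lborel)"
    using lborel_pair.integrable_fst[OF h] lborel_pair.Fubini_integral[OF h]
    by (simp add: has_bochner_integral_iff)
  then have "has_bochner_integral lebesgue
      (\<lambda>s. indicator {0..t} s *\<^sub>R ((LINT \<xi>:{s..t}|lebesgue. k \<xi> * r (\<xi> - s)) * f s))
      (\<integral>\<xi>. (\<integral>s. ?h s \<xi> \<partial>lborel) \<partial>lborel)"
  proof (rule has_bochner_integral_lebesgue_of_lborel, intro AE_I2)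
    fix s :: real
    consider "s < 0" | "t < s" | "0 \<le> s" "s \<le> t"
      by linarith
    then show "indicator {0..t} s *\<^sub>R ((LINT \<xi>:{s..t}|lebesgue. k \<xi> * r (\<xi> - s)) * f s) =
        (\<integral>\<xi>. ?h s \<xi> \<partial>lborel)"
    proof cases
      case 1 then show ?thesis using f'(2)[of s] by simp
    next
      case 2
      have "?h s \<xi> = 0" for \<xi>
        using 2 \<rho> by (cases "\<xi> \<le> t") (auto simp: borel_representative_def)
      then have "(\<integral>\<xi>. ?h s \<xi> \<partial>lborel) = 0"
        by (simp only: Bochner_Integration.integral_zero)
      then show ?thesis using 2 by simp
    next
      case 3
      then show ?thesis using t
        by (simp add: set_integral_shifted_kernel[OF \<rho> _ _ _ k] del: mult_scaleR_left)
    qed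
  qed
  moreover have "(\<integral>\<xi>. (\<integral>s. ?h s \<xi> \<partial>lborel) \<partial>lborel) = (LINT \<xi>:{0..t}|lebesgue. k \<xi> * convolution T r f \<xi>)"
  proof -
    have eq: "indicator {0..t} \<xi> *\<^sub>R (k \<xi> * convolution T r f \<xi>) = (\<integral>s. ?h s \<xi> \<partial>lborel)" for \<xi>
      using t by (cases "\<xi> \<in> {0..t}") (auto simp: conv mult.assoc)
    have "has_bochner_integral lborel (\<lambda>\<xi>. \<integral>s. ?h s \<xi> \<partial>lborel) (\<integral>\<xi>. (\<integral>s. ?h s \<xi> \<partial>lborel) \<partial>lborel)"
      using lborel_pair.integrable_snd[OF h] by (simp add: has_bochner_integral_iff)
    then have "has_bochner_integral lebesgue (\<lambda>\<xi>. indicator {0..t} \<xi> *\<^sub>R (k \<xi> * convolution T r f \<xi>))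
        (\<integral>\<xi>. (\<integral>s. ?h s \<xi> \<partial>lborel) \<partial>lborel)"
      by (rule has_bochner_integral_lebesgue_of_lborel) (simp add: eq)
    then show ?thesis
      by (simp add: set_lebesgue_integral_def has_bochner_integral_integral_eq)
  qed
  ultimately show ?thesis
    by simp
qed

theorem proposition6:
  fixes T :: real and N :: nat
    and r :: "real \<Rightarrow> complex"
    and q p :: "nat \<Rightarrow> real \<Rightarrow> complex"
    and B :: "nat \<Rightarrow> (real \<Rightarrow> complex) \<Rightarrow> (real \<Rightarrow> complex)"
    and K :: "real \<Rightarrow> real \<Rightarrow> complex"
  assumes "0 < T"
    and "admissible_causal_inverse T r"
    and "\<And>j. j \<in> {1..N} \<Longrightarrow> linear_operator_on (generator_domain T r) (B j)"
    and "\<And>j. j \<in> {1..N} \<Longrightarrow> power_bounded_kernel T (q j)"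
    and "\<And>j f. j \<in> {1..N} \<Longrightarrow> f \<in> C_interval T \<Longrightarrow>
           B j (convolution T r f) = convolution T (q j) f"
    and "\<And>j. j \<in> {1..N} \<Longrightarrow> p j \<in> C_interval T"
    and "continuous_on (causal_triangle T) (\<lambda>(t, s). K t s)"
  shows "\<forall>u \<in> generator_domain T r.
           perturbed_operator T r N p B K u =
           (\<lambda>t. generator T r u t +
                volterra T (perturbation_kernel r N p q K) (generator T r u) t)"
proof (intro ballI ext)
  fix u t assume "u \<in> generator_domain T r"
  then obtain f where f: "f \<in> C_interval T" and u: "u = convolution T r f"
    by (auto simp: generator_domain_def)
  have gen: "generator T r u = f"
    using assms(2) f by (simp add: generator_def u admissible_causal_inverse_def inv_into_f_f)
  have B: "B j u = convolution T (q j) f" if "j \<in> {1..N}" for j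
    using assms(5)[OF that f] by (simp add: u)
  have "(\<Sum>j=1..N. p j t * B j u t) + volterra T K u t =
      volterra T (perturbation_kernel r N p q K) f t"
  proof (cases "t \<in> {0..T}")
    case False
    have "B j u t = 0" if "j \<in> {1..N}" for j
      unfolding B[OF that] convolution_def volterra_def using False by (rule if_not_P)
    then have "(\<Sum>j=1..N. p j t * B j u t) = 0"
      by (intro sum.neutral) simp
    then show ?thesis
      using False by (simp only: volterra_def if_False add_0_left)
  next
    case t: True
    have K: "continuous_on {0..t} (K t)"
      using t by (intro continuous_on_compose2[OF assms(7), of _ "\<lambda>s. (t, s)", simplified])
        (auto intro!: continuous_intros simp: causal_triangle_def)
    obtain \<rho> where \<rho>: "borel_representative T r \<rho>"
      using assms(2) borel_representative_exists
      unfolding admissible_causal_inverse_def power_bounded_kernel_def by blast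
    have qj: "has_bochner_integral lebesgue
        (\<lambda>s. p j t * (indicator {0..t} s *\<^sub>R (q j (t - s) * f s))) (p j t * B j u t)"
      if j: "j \<in> {1..N}" for j
    proof (rule has_bochner_integral_mult_right)
      obtain \<sigma> where \<sigma>: "borel_representative T (q j) \<sigma>"
        using assms(4)[OF j] borel_representative_exists
          unfolding power_bounded_kernel_def by blast
      note * = has_bochner_integral_convolution_integrand[OF \<sigma> f t]
      show "has_bochner_integral lebesgue (\<lambda>s. indicator {0..t} s *\<^sub>R (q j (t - s) * f s)) (B j u t)"
        using * has_bochner_integral_integral_eq[OF *] t
        by (simp add: B[OF j] convolution_def volterra_def set_lebesgue_integral_def)
    qed
    have "has_bochner_integral lebesgue
       (\<lambda>s. (\<Sum>j=1..N. p j t * (indicator {0..t} s *\<^sub>R (q j (t - s) * f s))) +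
            indicator {0..t} s *\<^sub>R ((LINT \<xi>:{s..t}|lebesgue. K t \<xi> * r (\<xi> - s)) * f s))
       ((\<Sum>j=1..N. p j t * B j u t) + (LINT \<xi>:{0..t}|lebesgue. K t \<xi> * convolution T r f \<xi>))"
      by (intro has_bochner_integral_add has_bochner_integral_sum qj
          has_bochner_integral_volterra_convolution[OF \<rho> f t K])
    also have "(\<lambda>s. (\<Sum>j=1..N. p j t * (indicator {0..t} s *\<^sub>R (q j (t - s) * f s))) +
            indicator {0..t} s *\<^sub>R ((LINT \<xi>:{s..t}|lebesgue. K t \<xi> * r (\<xi> - s)) * f s)) =
        (\<lambda>s. indicator {0..t} s *\<^sub>R (perturbation_kernel r N p q K t s * f s))"
      by (auto simp: fun_eq_iff perturbation_kernel_def indicator_def algebra_simps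
          sum_distrib_left sum_distrib_right)
    finally show ?thesis
      using t by (simp add: volterra_def set_lebesgue_integral_def u has_bochner_integral_integral_eq)
  qed
  then show "perturbed_operator T r N p B K u t =
      generator T r u t + volterra T (perturbation_kernel r N p q K) (generator T r u) t"
    by (simp add: perturbed_operator_def gen add.assoc)
qed

end
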